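(* The L\"{o}wenheim-Skolem number of the class of finitely additive probability models with respect to probability logic $PL$ is $\aleph_0$.
   Context: Let $\mathcal{P}$ be a countable set of propositional variables. Probability logic $PL$ has formulas $p \mid \neg\varphi \mid \varphi\wedge\varphi \mid \varphi\vee\varphi \mid L_r\varphi \mid M_r\varphi$ with $p\in\mathcal{P}$, $r\in\mathbb{Q}\cap[0,1]$. A finitely additive probability model is $\mathfrak{M}=(\Omega,\mathcal{A},T,v)$ where $\mathcal{A}$ is an algebra over a nonempty set $\Omega$, for each $w\in\Omega$, $T(w)$ is a finitely additive probability measure on $\mathcal{A}$, for each $E\in\mathcal{A}$ and $r\in\mathbb{Q}\cap[0,1]$ the set $\{w\in\Omega \mid T(w)(E)\geq r\}$ is in $\mathcal{A}$, and $v:\mathcal{P}\to\mathcal{A}$. Satisfaction at a point $w$ is standard for propositional variables and Boolean connectives, and $\mathfrak{M},w\models L_r\varphi$ iff $T(w)(\{u\in\Omega \mid \mathfrak{M},u\models\varphi\})\geq r$, while $\mathfrak{M},w\models M_r\varphi$ iff $T(w)(\{u\in\Omega \mid \mathfrak{M},u\models\varphi\})\leq r$. The L\"{o}wenheim-Skolem number of a class of models with respect to a logic is the least infinite cardinal $\kappa$ such that every theory satisfiable in the class has a model in the class whose set of states has size at most $\kappa$. *)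

theory Defs
  imports "HOL-Analysis.Analysis"
begin

unbundle cardinal_syntax

typedef unit_rat = "{r :: rat. 0 \<le> r \<and> r \<le> 1}"
  by (rule exI[of _ 0]) simp

text \<open>\<open>AtLeast r \<phi>\<close> and \<open>AtMost r \<phi>\<close> are the formulas \<open>L\<^sub>r \<phi>\<close> and \<open>M\<^sub>r \<phi>\<close>.\<close>

datatype 'p form =
    Var 'p
  | Neg "'p form"
  | Conj "'p form" "'p form"
  | Disj "'p form" "'p form"
  | AtLeast unit_rat "'p form"
  | AtMost unit_rat "'p form"

definition rval :: "unit_rat \<Rightarrow> real" where
  "rval r = of_rat (Rep_unit_rat r)"

text \<open>The state space is a set of elements of \<^typ>\<open>'w\<close>, not the whole type. The values of \<open>kern\<close>
  at points outside the state space, or at sets that are not events, are irrelevant.\<close>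

record ('w, 'p) prob_structure =
  states :: "'w set"
  events :: "'w set set"
  kern :: "'w \<Rightarrow> 'w set \<Rightarrow> real"
  val :: "'p \<Rightarrow> 'w set"

definition fa_prob_measure :: "'w set \<Rightarrow> 'w set set \<Rightarrow> ('w set \<Rightarrow> real) \<Rightarrow> bool" where
  "fa_prob_measure \<Omega> \<A> \<mu> \<longleftrightarrow>
     (\<forall>E\<in>\<A>. 0 \<le> \<mu> E) \<and> \<mu> \<Omega> = 1 \<and> Measure_Space.additive \<A> \<mu>"

definition fa_prob_model :: "('w, 'p) prob_structure \<Rightarrow> bool" where
  "fa_prob_model \<MM> \<longleftrightarrow>
     states \<MM> \<noteq> {} \<and>
     algebra (states \<MM>) (events \<MM>) \<and>
     (\<forall>w\<in>states \<MM>. fa_prob_measure (states \<MM>) (events \<MM>) (kern \<MM> w)) \<and>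
     (\<forall>E\<in>events \<MM>. \<forall>r. {w \<in> states \<MM>. kern \<MM> w E \<ge> rval r} \<in> events \<MM>) \<and>
     (\<forall>p. val \<MM> p \<in> events \<MM>)"

primrec sat :: "('w, 'p) prob_structure \<Rightarrow> 'w \<Rightarrow> 'p form \<Rightarrow> bool" where
  "sat \<MM> w (Var p) \<longleftrightarrow> w \<in> val \<MM> p"
| "sat \<MM> w (Neg \<phi>) \<longleftrightarrow> \<not> sat \<MM> w \<phi>"
| "sat \<MM> w (Conj \<phi> \<psi>) \<longleftrightarrow> sat \<MM> w \<phi> \<and> sat \<MM> w \<psi>"
| "sat \<MM> w (Disj \<phi> \<psi>) \<longleftrightarrow> sat \<MM> w \<phi> \<or> sat \<MM> w \<psi>"
| "sat \<MM> w (AtLeast r \<phi>) \<longleftrightarrow> kern \<MM> w {u \<in> states \<MM>. sat \<MM> u \<phi>} \<ge> rval r"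
| "sat \<MM> w (AtMost r \<phi>) \<longleftrightarrow> kern \<MM> w {u \<in> states \<MM>. sat \<MM> u \<phi>} \<le> rval r"

definition satisfies_theory :: "('w, 'p) prob_structure \<Rightarrow> 'p form set \<Rightarrow> bool" where
  "satisfies_theory \<MM> \<Gamma> \<longleftrightarrow> (\<exists>w\<in>states \<MM>. \<forall>\<phi>\<in>\<Gamma>. sat \<MM> w \<phi>)"

text \<open>A class of models is given by its members with states in a type \<^typ>\<open>'w\<close>. Looking for the
  small model in the same type \<^typ>\<open>'w\<close> loses nothing for a class closed under isomorphism: a
  model of size at most \<open>\<kappa>\<close> can be copied into \<^typ>\<open>'w\<close> unless \<^typ>\<open>'w\<close> itself has fewer than
  \<open>\<kappa>\<close> elements, and in that case every model on \<^typ>\<open>'w\<close> is already small.\<close>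

definition LS_bound :: "('w, 'p) prob_structure set \<Rightarrow> 'k rel \<Rightarrow> bool" where
  "LS_bound \<C> \<kappa> \<longleftrightarrow>
     (\<forall>\<Gamma>. (\<exists>\<MM>\<in>\<C>. satisfies_theory \<MM> \<Gamma>) \<longrightarrow>
          (\<exists>\<NN>\<in>\<C>. satisfies_theory \<NN> \<Gamma> \<and> |states \<NN>| \<le>o \<kappa>))"

text \<open>Leastness is tested against cardinals on the type \<^typ>\<open>'k\<close> of \<open>\<kappa>\<close>; this is no restriction,
  because every cardinal below \<open>\<kappa>\<close> is isomorphic to one on a subset of \<^typ>\<open>'k\<close>.\<close>

definition is_LS_number :: "('w, 'p) prob_structure set \<Rightarrow> 'k rel \<Rightarrow> bool" where
  "is_LS_number \<C> \<kappa> \<longleftrightarrow>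
     Card_order \<kappa> \<and> cinfinite \<kappa> \<and> LS_bound \<C> \<kappa> \<and>
     (\<forall>\<kappa>' :: 'k rel. Card_order \<kappa>' \<and> cinfinite \<kappa>' \<and> LS_bound \<C> \<kappa>' \<longrightarrow> \<kappa> \<le>o \<kappa>')"

end

theory Submission
  imports Defs "HOL-Library.Countable_Set_Type"
begin

text \<open>The sets definable by formulas form a countable subalgebra of the events, closed under the
  operations \<open>E \<mapsto> {w. T(w)(E) \<ge> r}\<close>. A countable set of states that meets every nonempty
  definable set determines each definable set by its trace, so the kernel can be transported to
  the traces without changing the truth of any formula.\<close>

text \<open>Countably many modal indices and countably many variables give a countable language,
  which bounds the number of witnesses chosen in \<open>countable_dense_states\<close>.\<close>

instance unit_rat :: countable
  by (rule countable_classI[of "to_nat \<circ> Rep_unit_rat"]) (simp add: Rep_unit_rat_inject)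

instance form :: (countable) countable
  by countable_datatype

definition truth_set :: "('w, 'p) prob_structure \<Rightarrow> 'p form \<Rightarrow> 'w set" where
  "truth_set \<MM> \<phi> = {u \<in> states \<MM>. sat \<MM> u \<phi>}"

text \<open>Only traces of definable sets become events: a nonempty undefinable event may miss
  \<open>S\<close>, so its measure could not be read off its trace. \<open>inv_into\<close> recovers
  a definable set from its trace; for dense \<open>S\<close> the choice is unique.\<close>

definition trace_structure :: "('w, 'p) prob_structure \<Rightarrow> 'w set \<Rightarrow> ('w, 'p) prob_structure" where
  "trace_structure \<MM> S =
     \<lparr>states = S,
      events = (\<lambda>E. E \<inter> S) ` range (truth_set \<MM>),
      kern = (\<lambda>w X. kern \<MM> w (inv_into (range (truth_set \<MM>)) (\<lambda>E. E \<inter> S) X)),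
      val = (\<lambda>p. val \<MM> p \<inter> S)\<rparr>"

lemma algebra_eventsD: "fa_prob_model \<MM> \<Longrightarrow> algebra (states \<MM>) (events \<MM>)"
  by (simp add: fa_prob_model_def)

lemma kern_measure:
  "fa_prob_model \<MM> \<Longrightarrow> w \<in> states \<MM> \<Longrightarrow> fa_prob_measure (states \<MM>) (events \<MM>) (kern \<MM> w)"
  by (simp add: fa_prob_model_def)

lemma val_subset_states: "fa_prob_model \<MM> \<Longrightarrow> val \<MM> p \<subseteq> states \<MM>"
  by (meson algebra.axioms(1) algebra_eventsD fa_prob_model_def ring_of_sets.axioms(1)
      semiring_of_sets.axioms(1) subset_class.sets_into_space)

lemma truth_set_Neg: "truth_set \<MM> (Neg \<phi>) = states \<MM> - truth_set \<MM> \<phi>"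
  and truth_set_Conj: "truth_set \<MM> (Conj \<phi> \<psi>) = truth_set \<MM> \<phi> \<inter> truth_set \<MM> \<psi>"
  and truth_set_Disj: "truth_set \<MM> (Disj \<phi> \<psi>) = truth_set \<MM> \<phi> \<union> truth_set \<MM> \<psi>"
  and truth_set_AtLeast:
    "truth_set \<MM> (AtLeast r \<phi>) = {w \<in> states \<MM>. rval r \<le> kern \<MM> w (truth_set \<MM> \<phi>)}"
  and truth_set_AtMost:
    "truth_set \<MM> (AtMost r \<phi>) = {w \<in> states \<MM>. kern \<MM> w (truth_set \<MM> \<phi>) \<le> rval r}"
  by (auto simp: truth_set_def)

lemma truth_set_Var: "fa_prob_model \<MM> \<Longrightarrow> truth_set \<MM> (Var p) = val \<MM> p"
  using val_subset_states by (fastforce simp: truth_set_def)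

lemma fa_prob_measure_compl:
  assumes "algebra \<Omega> \<A>" "fa_prob_measure \<Omega> \<A> \<mu>" "E \<in> \<A>"
  shows "\<mu> (\<Omega> - E) = 1 - \<mu> E"
proof -
  interpret algebra \<Omega> \<A> by fact
  have "\<mu> (E \<union> (\<Omega> - E)) = \<mu> E + \<mu> (\<Omega> - E)"
    using assms(2,3) by (intro additiveD[of \<A>]) (auto simp: fa_prob_measure_def)
  moreover have "E \<union> (\<Omega> - E) = \<Omega>"
    using sets_into_space[OF assms(3)] by blast
  ultimately show ?thesis
    using assms(2) by (simp add: fa_prob_measure_def)
qed

text \<open>This turns an upper bound \<open>r\<close> on the measure of a set into the lower bound
  \<open>1 - r\<close> on that of its complement.\<close>

lemma rval_compl: "\<exists>s. rval s = 1 - rval r"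
proof
  have "0 \<le> Rep_unit_rat r" "Rep_unit_rat r \<le> 1"
    using Rep_unit_rat[of r] by auto
  then show "rval (Abs_unit_rat (1 - Rep_unit_rat r)) = 1 - rval r"
    by (simp add: rval_def Abs_unit_rat_inverse of_rat_diff)
qed

text \<open>Induction on the formula. The measure axioms speak about events only, so this is what
  makes them applicable to definable sets.\<close>

lemma truth_set_in_events:
  assumes M: "fa_prob_model \<MM>"
  shows "truth_set \<MM> \<phi> \<in> events \<MM>"
proof (induction \<phi>)
  case (Var p)
  then show ?case
    using M by (simp add: truth_set_Var) (simp add: fa_prob_model_def)
next
  case (AtLeast r \<phi>)
  then show ?case
    using M by (simp add: truth_set_AtLeast fa_prob_model_def)
next
  case (AtMost r \<phi>)
  interpret algebra "states \<MM>" "events \<MM>"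
    by (rule algebra_eventsD[OF M])
  obtain s where s: "rval s = 1 - rval r"
    using rval_compl by blast
  have "kern \<MM> w (states \<MM> - truth_set \<MM> \<phi>) = 1 - kern \<MM> w (truth_set \<MM> \<phi>)"
    if "w \<in> states \<MM>" for w
    using fa_prob_measure_compl[OF algebra_eventsD[OF M] kern_measure[OF M that] AtMost] .
  \<comment> \<open>Models close events under lower thresholds, so the upper threshold is rewritten
    as a lower one on the complement.\<close>
  then have "truth_set \<MM> (AtMost r \<phi>) =
      {w \<in> states \<MM>. rval s \<le> kern \<MM> w (states \<MM> - truth_set \<MM> \<phi>)}"
    by (auto simp: truth_set_AtMost s)
  moreover have "states \<MM> - truth_set \<MM> \<phi> \<in> events \<MM>"
    using AtMost by (rule compl_sets)
  ultimately show ?case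
    using M by (simp add: fa_prob_model_def)
next
  case (Neg \<phi>)
  then show ?case
    using algebra.compl_sets[OF algebra_eventsD[OF M]] by (simp add: truth_set_Neg)
next
  case (Conj \<phi> \<psi>)
  then show ?case
    using algebra_eventsD[OF M] by (simp add: truth_set_Conj algebra_iff_Int)
next
  case (Disj \<phi> \<psi>)
  then show ?case
    using algebra_eventsD[OF M] by (simp add: truth_set_Disj algebra_iff_Un)
qed

text \<open>\<open>S_dense\<close> is density in the topology with the definable sets as a
  basis.\<close>

locale dense_states =
  fixes \<MM> :: "('w, 'p) prob_structure" and S :: "'w set"
  assumes model: "fa_prob_model \<MM>"
    and S_subset: "S \<subseteq> states \<MM>"
    and S_dense: "truth_set \<MM> \<phi> \<noteq> {} \<Longrightarrow> truth_set \<MM> \<phi> \<inter> S \<noteq> {}"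
begin

text \<open>Both differences of two definable sets are definable. If the traces agree, the
  differences have empty trace, and density makes them empty.\<close>

lemma truth_set_eq_iff_trace:
  "truth_set \<MM> \<phi> \<inter> S = truth_set \<MM> \<psi> \<inter> S \<longleftrightarrow> truth_set \<MM> \<phi> = truth_set \<MM> \<psi>"
proof
  assume eq: "truth_set \<MM> \<phi> \<inter> S = truth_set \<MM> \<psi> \<inter> S"
  have "truth_set \<MM> (Conj \<phi> (Neg \<psi>)) \<inter> S = {}" "truth_set \<MM> (Conj \<psi> (Neg \<phi>)) \<inter> S = {}"
    using eq by (auto simp: truth_set_Conj truth_set_Neg)
  then have "truth_set \<MM> (Conj \<phi> (Neg \<psi>)) = {}" "truth_set \<MM> (Conj \<psi> (Neg \<phi>)) = {}"
    using S_dense by blast+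
  then show "truth_set \<MM> \<phi> = truth_set \<MM> \<psi>"
    by (auto simp: truth_set_def)
qed simp

text \<open>Taking traces is injective on definable sets, so \<open>inv_into\<close> returns
  \<open>truth_set \<MM> \<phi>\<close> itself.\<close>

lemma kern_trace:
  "kern (trace_structure \<MM> S) w (truth_set \<MM> \<phi> \<inter> S) = kern \<MM> w (truth_set \<MM> \<phi>)"
proof -
  have "inj_on (\<lambda>E. E \<inter> S) (range (truth_set \<MM>))"
    by (auto simp: inj_on_def truth_set_eq_iff_trace)
  then have "inv_into (range (truth_set \<MM>)) (\<lambda>E. E \<inter> S) (truth_set \<MM> \<phi> \<inter> S) = truth_set \<MM> \<phi>"
    by (simp add: inv_into_f_eq)
  then show ?thesis
    by (simp add: trace_structure_def)
qed

lemma states_trace: "states (trace_structure \<MM> S) = S"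
  by (simp add: trace_structure_def)

lemma events_trace: "events (trace_structure \<MM> S) = {truth_set \<MM> \<phi> \<inter> S |\<phi>. True}"
  by (auto simp: trace_structure_def)

text \<open>In the modal cases the induction hypothesis, used at all states of \<open>S\<close>,
  shows that the truth set in the new structure is the trace of the old one;
  \<open>kern_trace\<close> then gives equal measures.\<close>

lemma sat_trace: "w \<in> S \<Longrightarrow> sat (trace_structure \<MM> S) w \<phi> \<longleftrightarrow> sat \<MM> w \<phi>"
proof (induction \<phi> arbitrary: w)
  case (Var p)
  then show ?case by (simp add: trace_structure_def)
next
  case (AtLeast r \<phi>)
  then have "{u \<in> S. sat (trace_structure \<MM> S) u \<phi>} = truth_set \<MM> \<phi> \<inter> S"
    using S_subset by (auto simp: truth_set_def)
  then show ?case
    by (simp add: states_trace kern_trace) (simp add: truth_set_def)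
next
  case (AtMost r \<phi>)
  then have "{u \<in> S. sat (trace_structure \<MM> S) u \<phi>} = truth_set \<MM> \<phi> \<inter> S"
    using S_subset by (auto simp: truth_set_def)
  then show ?case
    by (simp add: states_trace kern_trace) (simp add: truth_set_def)
qed simp_all

text \<open>The language has no constant for truth; excluded middle supplies a formula defining the
  whole space.\<close>

lemma truth_set_taut: "truth_set \<MM> (Disj \<phi> (Neg \<phi>)) = states \<MM>"
  by (auto simp: truth_set_def)

text \<open>Each Boolean operation on traces is matched by a connective, and a contradiction defines
  the empty set.\<close>

lemma algebra_trace: "algebra S (events (trace_structure \<MM> S))"
  unfolding algebra_iff_Un
proof (intro conjI ballI)
  show "events (trace_structure \<MM> S) \<subseteq> Pow S"
    by (auto simp: events_trace)
  have "truth_set \<MM> (Conj \<phi> (Neg \<phi>)) \<inter> S = {}" for \<phi>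
    by (auto simp: truth_set_def)
  then show "{} \<in> events (trace_structure \<MM> S)"
    unfolding events_trace by blast
next
  fix X assume "X \<in> events (trace_structure \<MM> S)"
  then obtain \<phi> where "X = truth_set \<MM> \<phi> \<inter> S"
    by (auto simp: events_trace)
  then have "S - X = truth_set \<MM> (Neg \<phi>) \<inter> S"
    using S_subset by (auto simp: truth_set_Neg)
  then show "S - X \<in> events (trace_structure \<MM> S)"
    unfolding events_trace by blast
next
  fix X Y assume "X \<in> events (trace_structure \<MM> S)" "Y \<in> events (trace_structure \<MM> S)"
  then obtain \<phi> \<psi> where "X = truth_set \<MM> \<phi> \<inter> S" "Y = truth_set \<MM> \<psi> \<inter> S"
    by (auto simp: events_trace)
  then have "X \<union> Y = truth_set \<MM> (Disj \<phi> \<psi>) \<inter> S"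
    by (auto simp: truth_set_Disj)
  then show "X \<union> Y \<in> events (trace_structure \<MM> S)"
    unfolding events_trace by blast
qed

lemma fa_prob_measure_trace:
  assumes "w \<in> S"
  shows "fa_prob_measure S (events (trace_structure \<MM> S)) (kern (trace_structure \<MM> S) w)"
proof -
  have \<mu>: "fa_prob_measure (states \<MM>) (events \<MM>) (kern \<MM> w)"
    using kern_measure[OF model] assms S_subset by blast
  show ?thesis
    unfolding fa_prob_measure_def Measure_Space.additive_def
  proof (intro conjI ballI impI)
    fix X assume "X \<in> events (trace_structure \<MM> S)"
    then show "0 \<le> kern (trace_structure \<MM> S) w X"
      using \<mu> truth_set_in_events[OF model]
      by (auto simp: events_trace kern_trace fa_prob_measure_def)
  next
    have "S = truth_set \<MM> (Disj \<phi> (Neg \<phi>)) \<inter> S" for \<phi>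
      using S_subset by (auto simp: truth_set_taut)
    then have "kern (trace_structure \<MM> S) w S = kern \<MM> w (states \<MM>)"
      using kern_trace truth_set_taut by metis
    then show "kern (trace_structure \<MM> S) w S = 1"
      using \<mu> by (simp add: fa_prob_measure_def)
  next
    fix X Y
    assume "X \<in> events (trace_structure \<MM> S)" "Y \<in> events (trace_structure \<MM> S)"
      and disj: "X \<inter> Y = {}"
    then obtain \<phi> \<psi> where X: "X = truth_set \<MM> \<phi> \<inter> S" and Y: "Y = truth_set \<MM> \<psi> \<inter> S"
      by (auto simp: events_trace)
    \<comment> \<open>Disjoint traces might come from overlapping sets. The overlap is definable by
      a conjunction, so density rules this out and additivity of the original measure
      applies.\<close>
    have "truth_set \<MM> (Conj \<phi> \<psi>) \<inter> S = {}"
      using disj by (auto simp: X Y truth_set_Conj)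
    then have "truth_set \<MM> \<phi> \<inter> truth_set \<MM> \<psi> = {}"
      using S_dense truth_set_Conj by metis
    then have "kern \<MM> w (truth_set \<MM> \<phi> \<union> truth_set \<MM> \<psi>) =
        kern \<MM> w (truth_set \<MM> \<phi>) + kern \<MM> w (truth_set \<MM> \<psi>)"
      using \<mu> truth_set_in_events[OF model]
      by (auto simp: fa_prob_measure_def intro!: additiveD)
    moreover have "X \<union> Y = truth_set \<MM> (Disj \<phi> \<psi>) \<inter> S"
      by (auto simp: X Y truth_set_Disj)
    ultimately show "kern (trace_structure \<MM> S) w (X \<union> Y) =
        kern (trace_structure \<MM> S) w X + kern (trace_structure \<MM> S) w Y"
      by (simp add: X Y kern_trace) (simp add: truth_set_Disj)
  qed
qed

lemma fa_prob_model_trace: "fa_prob_model (trace_structure \<MM> S)"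
  unfolding fa_prob_model_def states_trace
proof (intro conjI ballI allI)
  have "truth_set \<MM> (Disj \<phi> (Neg \<phi>)) \<noteq> {}" for \<phi>
    using model by (simp add: truth_set_taut fa_prob_model_def)
  then show "S \<noteq> {}"
    using S_dense by blast
  show "algebra S (events (trace_structure \<MM> S))"
    by (rule algebra_trace)
next
  fix w assume "w \<in> S"
  then show "fa_prob_measure S (events (trace_structure \<MM> S)) (kern (trace_structure \<MM> S) w)"
    by (rule fa_prob_measure_trace)
next
  fix X r assume "X \<in> events (trace_structure \<MM> S)"
  then obtain \<phi> where X: "X = truth_set \<MM> \<phi> \<inter> S"
    by (auto simp: events_trace)
  \<comment> \<open>The threshold set of a trace is again a trace, because \<open>AtLeast\<close>
    defines it in the original model.\<close>
  have "{w \<in> S. rval r \<le> kern (trace_structure \<MM> S) w X} = truth_set \<MM> (AtLeast r \<phi>) \<inter> S"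
    using S_subset by (auto simp: X kern_trace truth_set_AtLeast)
  then show "{w \<in> S. rval r \<le> kern (trace_structure \<MM> S) w X} \<in> events (trace_structure \<MM> S)"
    unfolding events_trace by blast
next
  fix p
  have "val (trace_structure \<MM> S) p = truth_set \<MM> (Var p) \<inter> S"
    using model by (simp add: truth_set_Var) (simp add: trace_structure_def)
  then show "val (trace_structure \<MM> S) p \<in> events (trace_structure \<MM> S)"
    unfolding events_trace by blast
qed

end

lemma countable_dense_states:
  fixes \<MM> :: "('w, 'p :: countable) prob_structure"
  assumes "fa_prob_model \<MM>" "w \<in> states \<MM>"
  obtains S where "countable S" "w \<in> S" "dense_states \<MM> S"
proof
  \<comment> \<open>One witness for each satisfiable formula gives density; \<open>w\<close> is
    added so that the state realizing a given theory survives.\<close>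
  let ?S = "insert w ((\<lambda>\<phi>. SOME u. u \<in> truth_set \<MM> \<phi>) ` {\<phi>. truth_set \<MM> \<phi> \<noteq> {}})"
  have some: "(SOME u. u \<in> truth_set \<MM> \<phi>) \<in> truth_set \<MM> \<phi>" if "truth_set \<MM> \<phi> \<noteq> {}" for \<phi>
    using that by (simp add: some_in_eq)
  show "countable ?S" "w \<in> ?S" by auto
  show "dense_states \<MM> ?S"
  proof
    show "?S \<subseteq> states \<MM>"
      using assms(2) some by (auto simp: truth_set_def)
    show "truth_set \<MM> \<phi> \<inter> ?S \<noteq> {}" if "truth_set \<MM> \<phi> \<noteq> {}" for \<phi>
      using that some[OF that] by blast
  qed fact
qed

theorem theorem3p4:
  shows "is_LS_number {\<MM> :: ('w, 'p :: countable) prob_structure. fa_prob_model \<MM>} natLeq"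
  unfolding is_LS_number_def
proof (intro conjI allI impI)
  show "LS_bound {\<MM> :: ('w, 'p) prob_structure. fa_prob_model \<MM>} natLeq"
    unfolding LS_bound_def
  proof (intro allI impI)
    fix \<Gamma> :: "'p form set"
    assume "\<exists>\<MM> \<in> {\<MM> :: ('w, 'p) prob_structure. fa_prob_model \<MM>}. satisfies_theory \<MM> \<Gamma>"
    then obtain \<MM> :: "('w, 'p) prob_structure" and w
      where M: "fa_prob_model \<MM>" "w \<in> states \<MM>" and sat: "\<forall>\<phi>\<in>\<Gamma>. sat \<MM> w \<phi>"
      by (auto simp: satisfies_theory_def)
    obtain S where S: "countable S" "w \<in> S" "dense_states \<MM> S"
      using countable_dense_states[OF M] .
    interpret dense_states \<MM> S by fact
    \<comment> \<open>The theory holds at the same state \<open>w\<close>, and the new states are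
      still elements of the original type, as \<open>LS_bound\<close> demands.\<close>
    have "satisfies_theory (trace_structure \<MM> S) \<Gamma>"
      using S(2) sat by (auto simp: satisfies_theory_def states_trace sat_trace)
    moreover have "|states (trace_structure \<MM> S)| \<le>o natLeq"
      using S(1) by (simp add: states_trace countable_card_le_natLeq)
    ultimately show "\<exists>\<NN> \<in> {\<MM> :: ('w, 'p) prob_structure. fa_prob_model \<MM>}.
        satisfies_theory \<NN> \<Gamma> \<and> |states \<NN>| \<le>o natLeq"
      using fa_prob_model_trace by blast
  qed
\<comment> \<open>Leastness holds because every competing cardinal is infinite and
  \<open>natLeq\<close> lies below every infinite cardinal.\<close>
qed (auto simp: natLeq_Card_order natLeq_cinfinite natLeq_ordLeq_cinfinite)

end
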